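(* Let $G$ be a connected graph of order $n$. If $\sigma_2(G)\ge n-k+1$ for some positive integer $k$, then $G$ has a spanning tree $T$ with at most $k-|B(T)|+1$ end vertices, where $B(T)$ is the set of branch vertices of $T$.
   Context: All graphs are finite, undirected, without loops or multiple edges. For a graph $G$, $\sigma_2(G)$ denotes the minimum of $d_G(u)+d_G(v)$ over all pairs of distinct nonadjacent vertices $u,v$ of $G$; if $G$ has no two nonadjacent vertices (i.e. $G$ is complete), $\sigma_2(G)=+\infty$. An end vertex of a tree is a vertex of degree one in the tree. A branch vertex of a tree $T$ is a vertex of degree at least three in $T$; $B(T)$ denotes the set of branch vertices of $T$. *)

theory Defs
  imports "HOL-Library.Extended_Real" "Graph_Theory.Pair_Digraph" "Graph_Theory.Digraph_Component"
begin

text \<open>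
  A finite simple graph is a \<^locale>\<open>pair_graph\<close>: a finite loop-free digraph with symmetric arc set
  of ordered pairs. Each undirected edge is thus a pair of opposite arcs, so the degree of a vertex
  is its out-degree.
\<close>

abbreviation deg :: "'a pair_pre_digraph \<Rightarrow> 'a \<Rightarrow> nat" where
  "deg G v \<equiv> out_degree (with_proj G) v"

text \<open>The infimum of the empty set in \<^typ>\<open>enat\<close> is \<^term>\<open>\<infinity> :: enat\<close>; of any other set it is the minimum.\<close>

definition sigma2 :: "'a pair_pre_digraph \<Rightarrow> enat" where
  "sigma2 G =
    (INF (u, v) \<in> {(u, v). u \<in> pverts G \<and> v \<in> pverts G \<and> u \<noteq> v \<and> (u, v) \<notin> parcs G}.
      enat (deg G u + deg G v))"

text \<open>
  \<^const>\<open>Digraph_Component.tree\<close> is unsuitable here: it counts the closed walk \<open>a, b, a\<close>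
  along an edge as a cycle. In a simple graph, the undirected cycles are the directed cycles of
  length at least three.
\<close>

definition undirected_tree :: "'a pair_pre_digraph \<Rightarrow> bool" where
  "undirected_tree T \<longleftrightarrow>
    pair_graph T \<and> Digraph_Component.connected (with_proj T) \<and>
    \<not> (\<exists>p. pre_digraph.cycle (with_proj T) p \<and> length p \<ge> 3)"

definition undirected_spanning_tree :: "'a pair_pre_digraph \<Rightarrow> 'a pair_pre_digraph \<Rightarrow> bool" where
  "undirected_spanning_tree T G \<longleftrightarrow> undirected_tree T \<and> spanning (with_proj T) (with_proj G)"

definition end_vertices :: "'a pair_pre_digraph \<Rightarrow> 'a set" where
  "end_vertices T = {v \<in> pverts T. deg T v = 1}"

definition branch_vertices :: "'a pair_pre_digraph \<Rightarrow> 'a set" where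
  "branch_vertices T = {v \<in> pverts T. deg T v \<ge> 3}"

end

theory Submission
  imports Defs
begin

text \<open>
  Among the spanning trees with fewest leaves take those with fewest branch vertices, and suppose
  that there are at least three leaves. Two leaves are then never adjacent in \<open>G\<close>, since adding the
  edge between them and deleting a tree edge at a branch vertex of the resulting cycle saves a leaf.

  Root the tree at a leaf \<open>u\<close>, let \<open>c\<close> be a branch vertex, and choose tree, \<open>u\<close> and \<open>c\<close> such that
  the number of descendants of \<open>c\<close> is minimal. Only legs hang below \<open>c\<close>. If the leaf \<open>v\<close> of such a
  leg were adjacent to a branch vertex other than \<open>c\<close>, the leg could be moved there, which either
  destroys the branch vertex \<open>c\<close> without creating new leaves or decreases the number of descendants.

  If \<open>x\<close> is a neighbour of \<open>u\<close> in \<open>G\<close> with parent \<open>p x \<noteq> u\<close>, then replacing the edge from \<open>x\<close> to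
  \<open>p x\<close> by the one from \<open>x\<close> to \<open>u\<close> shows that \<open>p x\<close> has degree two in the tree and is not adjacent
  to \<open>v\<close>. Hence the neighbours of \<open>v\<close>, the parents of the neighbours of \<open>u\<close>, the leaves other than
  \<open>u\<close> and the branch vertices other than \<open>c\<close> are four disjoint sets, which bounds the degree sum of
  \<open>u\<close> and \<open>v\<close>.
\<close>

section \<open>Trees as symmetric relations\<close>

definition connected_on :: "'a set \<Rightarrow> 'a rel \<Rightarrow> bool" where
  "connected_on V T \<longleftrightarrow> (\<forall>x\<in>V. \<forall>y\<in>V. (x, y) \<in> T\<^sup>*)"

text \<open>
  \<open>T\<close> holds both arcs of each edge, so a tree is a connected graph with \<open>2 * (card V - 1)\<close> arcs.
\<close>

definition spanning_tree_on :: "'a set \<Rightarrow> 'a rel \<Rightarrow> bool" where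
  "spanning_tree_on V T \<longleftrightarrow> T \<subseteq> V \<times> V \<and> sym T \<and> irrefl T \<and> connected_on V T \<and>
     card T = 2 * (card V - 1)"

definition degree_in :: "'a rel \<Rightarrow> 'a \<Rightarrow> nat" where
  "degree_in T x = card (T `` {x})"

definition leaves :: "'a set \<Rightarrow> 'a rel \<Rightarrow> 'a set" where
  "leaves V T = {x \<in> V. degree_in T x = 1}"

definition branches :: "'a set \<Rightarrow> 'a rel \<Rightarrow> 'a set" where
  "branches V T = {x \<in> V. degree_in T x \<ge> 3}"

section \<open>Connectivity and rooted trees\<close>

lemma connected_on_from_root:
  assumes "sym T" "\<And>x. x \<in> V \<Longrightarrow> (x, u) \<in> T\<^sup>*"
  shows "connected_on V T"
  unfolding connected_on_def
proof (intro ballI)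
  fix x y assume "x \<in> V" "y \<in> V"
  then have "(x, u) \<in> T\<^sup>*" "(u, y) \<in> T\<^sup>*"
    using assms(2) symD[OF sym_rtrancl[OF assms(1)]] by blast+
  then show "(x, y) \<in> T\<^sup>*" by (rule rtrancl_trans)
qed

text \<open>Take for \<open>d\<close> the distance to \<open>u\<close> and for \<open>p x\<close>
  the next vertex on a shortest path from \<open>x\<close> to \<open>u\<close>.\<close>

lemma connected_on_parent:
  assumes "T \<subseteq> V \<times> V" "connected_on V T" "u \<in> V"
  obtains p and d :: "'a \<Rightarrow> nat"
  where "\<And>x. x \<in> V \<Longrightarrow> x \<noteq> u \<Longrightarrow> p x \<in> V \<and> (x, p x) \<in> T \<and> d (p x) < d x"
proof -
  define d where "d x = (LEAST n. (x, u) \<in> T ^^ n)" for x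
  have "\<exists>y. y \<in> V \<and> (x, y) \<in> T \<and> d y < d x" if x: "x \<in> V" "x \<noteq> u" for x
  proof -
    have "\<exists>n. (x, u) \<in> T ^^ n"
      using assms x unfolding connected_on_def by (simp add: rtrancl_imp_relpow)
    then have dx: "(x, u) \<in> T ^^ d x"
      unfolding d_def by (rule LeastI_ex)
    then obtain m where m: "d x = Suc m"
      using x by (cases "d x") auto
    then obtain y where y: "(x, y) \<in> T" "(y, u) \<in> T ^^ m"
      using dx by (metis relpow_Suc_E2)
    then have "d y \<le> m" unfolding d_def by (simp add: Least_le)
    then show ?thesis using y m assms(1) by force
  qed
  then have "\<exists>p. \<forall>x. x \<in> V \<and> x \<noteq> u \<longrightarrow> p x \<in> V \<and> (x, p x) \<in> T \<and> d (p x) < d x"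
    by metis
  then show ?thesis using that by blast
qed

text \<open>Any \<open>d\<close> that decreases from child to parent will do; it excludes cycles of
  \<open>p\<close>. The value \<open>p u\<close> is left arbitrary.\<close>

locale rooted_tree =
  fixes V :: "'a set" and T :: "'a rel" and u :: 'a and p :: "'a \<Rightarrow> 'a" and d :: "'a \<Rightarrow> nat"
  assumes finite_V: "finite V"
    and root_in: "u \<in> V"
    and parent_in: "x \<in> V \<Longrightarrow> x \<noteq> u \<Longrightarrow> p x \<in> V"
    and depth_parent: "x \<in> V \<Longrightarrow> x \<noteq> u \<Longrightarrow> d (p x) < d x"
    and tree_eq: "T = (\<lambda>x. (x, p x)) ` (V - {u}) \<union> ((\<lambda>x. (x, p x)) ` (V - {u}))\<inverse>"
begin

definition up :: "'a rel" where
  "up = (\<lambda>x. (x, p x)) ` (V - {u})"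

definition desc :: "'a \<Rightarrow> 'a set" where
  "desc w = {x \<in> V. (x, w) \<in> up\<^sup>*}"

lemma up_iff: "(x, y) \<in> up \<longleftrightarrow> x \<in> V \<and> x \<noteq> u \<and> y = p x"
  unfolding up_def by auto

lemma tree_iff: "(x, y) \<in> T \<longleftrightarrow> (x, y) \<in> up \<or> (y, x) \<in> up"
  unfolding tree_eq up_def by auto

lemma tree_subset: "T \<subseteq> V \<times> V"
  using parent_in by (auto simp: tree_iff up_iff)

lemma finite_T: "finite T"
  using tree_subset finite_V finite_subset by blast

lemma up_depth: "(x, y) \<in> up \<Longrightarrow> d y < d x"
  using depth_parent by (auto simp: up_iff)

lemma up_rtrancl_depth: "(x, y) \<in> up\<^sup>* \<Longrightarrow> x = y \<or> d y < d x"
  by (induction rule: rtrancl_induct) (auto dest: up_depth)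

lemma sym_tree: "sym T"
  by (auto simp: sym_def tree_iff)

lemma irrefl_tree: "irrefl T"
  by (auto simp: irrefl_def tree_iff dest: up_depth)

lemma up_to_root: "x \<in> V \<Longrightarrow> (x, u) \<in> up\<^sup>*"
proof (induction "d x" arbitrary: x rule: less_induct)
  case less
  show ?case
  proof (cases "x = u")
    case False
    then have "(p x, u) \<in> up\<^sup>*" "(x, p x) \<in> up"
      using less depth_parent parent_in by (auto simp: up_iff)
    then show ?thesis by (rule converse_rtrancl_into_rtrancl[rotated])
  qed simp
qed

lemma connected_tree: "connected_on V T"
proof (rule connected_on_from_root[OF sym_tree])
  fix x assume "x \<in> V"
  moreover have "up \<subseteq> T" by (auto simp: tree_iff)
  ultimately show "(x, u) \<in> T\<^sup>*"
    using up_to_root rtrancl_mono by blast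
qed

lemma card_tree: "card T = 2 * (card V - 1)"
proof -
  have "card up = card V - 1"
    unfolding up_def using finite_V root_in by (subst card_image) (auto simp: inj_on_def)
  moreover have "card (up\<inverse>) = card up" by (rule card_inverse)
  moreover have "up \<inter> up\<inverse> = {}" using up_depth less_asym by blast
  moreover have "finite up" unfolding up_def using finite_V by simp
  ultimately have "card (up \<union> up\<inverse>) = 2 * (card V - 1)"
    by (simp add: card_Un_disjoint)
  then show ?thesis unfolding tree_eq up_def .
qed

lemma spanning_tree: "spanning_tree_on V T"
  unfolding spanning_tree_on_def
  using tree_subset sym_tree irrefl_tree connected_tree card_tree by blast

lemma finite_nbrs: "finite (T `` {x})"
  using finite_T by (rule finite_Image)

lemma finite_desc: "finite (desc w)"
  unfolding desc_def using finite_V by simp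

lemma desc_self: "w \<in> V \<Longrightarrow> w \<in> desc w"
  by (simp add: desc_def)

lemma root_notin_desc: "w \<noteq> u \<Longrightarrow> u \<notin> desc w"
  by (auto simp: desc_def up_iff elim: converse_rtranclE)

text \<open>An arc from parent to child stays below \<open>w\<close>. Since parents are unique, an
  arc from child to parent is the first step on the way from \<open>a\<close> up to
  \<open>w\<close>, unless \<open>a\<close> is \<open>w\<close> itself.\<close>

lemma desc_exit:
  assumes "(a, b) \<in> T" "a \<in> desc w" "b \<notin> desc w"
  shows "a = w \<and> b = p w"
proof -
  have "b \<in> V" using assms tree_subset by auto
  have "(b, a) \<notin> up"
    using assms \<open>b \<in> V\<close> by (auto simp: desc_def intro: converse_rtrancl_into_rtrancl)
  then have ab: "(a, b) \<in> up" using assms by (auto simp: tree_iff)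
  have "(a, w) \<in> up\<^sup>*" using assms by (simp add: desc_def)
  then show ?thesis
  proof (cases rule: converse_rtranclE)
    case base
    then show ?thesis using ab by (simp add: up_iff)
  next
    case (step y)
    then have "y = b" using ab by (simp add: up_iff)
    then show ?thesis using step assms \<open>b \<in> V\<close> by (simp add: desc_def)
  qed
qed

text \<open>Together with \<open>not_desc_path\<close>, this shows that deleting the edge between
  \<open>w\<close> and \<open>p w\<close> leaves two connected pieces.\<close>

lemma desc_path:
  assumes "x \<in> desc w"
  shows "(x, w) \<in> {(a, b) \<in> T. a \<in> desc w \<and> b \<in> desc w}\<^sup>*"
proof -
  have "(x, w) \<in> up\<^sup>*" "x \<in> V" using assms by (auto simp: desc_def)
  then show ?thesis
  proof (induction rule: converse_rtrancl_induct)
    case (step y z)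
    have "z \<in> V" using step by (auto simp: up_iff parent_in)
    moreover have "(y, z) \<in> T" "y \<in> desc w" "z \<in> desc w"
      using step \<open>z \<in> V\<close> by (auto simp: tree_iff desc_def intro: converse_rtrancl_into_rtrancl)
    ultimately show ?case
      using step.IH by (auto intro: converse_rtrancl_into_rtrancl)
  qed simp
qed

lemma not_desc_path:
  assumes "x \<in> V" "x \<notin> desc w"
  shows "(x, u) \<in> {(a, b) \<in> T. a \<notin> desc w \<and> b \<notin> desc w}\<^sup>*"
  using up_to_root[OF assms(1)] assms
proof (induction rule: converse_rtrancl_induct)
  case (step y z)
  have "z \<in> V" using step by (auto simp: up_iff parent_in)
  moreover have "z \<notin> desc w"
    using step by (auto simp: desc_def intro: converse_rtrancl_into_rtrancl)
  moreover have "(y, z) \<in> T" using step by (simp add: tree_iff)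
  ultimately show ?case
    using step by (auto intro: converse_rtrancl_into_rtrancl)
qed simp

lemma desc_trans: "x \<in> desc y \<Longrightarrow> y \<in> desc z \<Longrightarrow> x \<in> desc z"
  unfolding desc_def by auto

lemma desc_antisym: "x \<in> desc y \<Longrightarrow> y \<in> desc x \<Longrightarrow> x = y"
  using up_rtrancl_depth[of x y] up_rtrancl_depth[of y x] by (auto simp: desc_def)

lemma desc_psubset: "y \<in> desc z \<Longrightarrow> y \<noteq> z \<Longrightarrow> z \<in> V \<Longrightarrow> desc y \<subset> desc z"
  using desc_trans desc_antisym desc_self by blast

lemma desc_child:
  assumes "v \<in> desc c" "v \<noteq> c"
  obtains w where "w \<in> V" "w \<noteq> u" "p w = c" "v \<in> desc w"
proof -
  have "(v, c) \<in> up\<^sup>*" "v \<in> V" using assms by (auto simp: desc_def)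
  then obtain w where "(v, w) \<in> up\<^sup>*" "(w, c) \<in> up"
    using assms(2) by (auto elim: rtranclE)
  then show ?thesis using that \<open>v \<in> V\<close> by (auto simp: up_iff desc_def)
qed

lemma child_in_desc: "w \<in> V \<Longrightarrow> w \<noteq> u \<Longrightarrow> w \<in> desc (p w)"
  by (auto simp: desc_def up_iff)

lemma parent_notin_desc: "w \<in> V \<Longrightarrow> w \<noteq> u \<Longrightarrow> p w \<notin> desc w"
  using desc_antisym[of w "p w"] child_in_desc[of w] depth_parent[of w] by auto

lemma nbrs_eq: "x \<in> V \<Longrightarrow> x \<noteq> u \<Longrightarrow> T `` {x} = insert (p x) {y \<in> V - {u}. p y = x}"
  by (auto simp: tree_iff up_iff)

lemma parent_in_nbrs: "x \<in> V \<Longrightarrow> x \<noteq> u \<Longrightarrow> p x \<in> T `` {x}"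
  by (auto simp: tree_iff up_iff)

lemma child_in_nbrs: "y \<in> V \<Longrightarrow> y \<noteq> u \<Longrightarrow> y \<in> T `` {p y}"
  by (auto simp: tree_iff up_iff)

lemma child_neq_grandparent: "y \<in> V \<Longrightarrow> y \<noteq> u \<Longrightarrow> p y \<noteq> u \<Longrightarrow> p (p y) \<noteq> y"
  using depth_parent[of y] depth_parent[of "p y"] parent_in[of y] by auto

lemma degree_inner:
  assumes "y \<in> V" "y \<noteq> u" "p y \<noteq> u"
  shows "degree_in T (p y) \<ge> 2"
proof -
  have "card {y, p (p y)} \<le> card (T `` {p y})"
    using assms parent_in child_in_nbrs parent_in_nbrs by (intro card_mono finite_nbrs) auto
  then show ?thesis
    using child_neq_grandparent[OF assms] by (auto simp: degree_in_def)
qed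

text \<open>A second child would exceed the degree bound. The bound is smaller at the root, which
  has no parent among its neighbours.\<close>

lemma unique_child:
  assumes "y \<in> V" "y \<noteq> u" "z \<in> V" "z \<noteq> u" "p y = p z"
    and "degree_in T (p y) \<le> (if p y = u then 1 else 2)"
  shows "y = z"
proof (rule ccontr)
  assume "y \<noteq> z"
  show False
  proof (cases "p y = u")
    case True
    have "card {y, z} \<le> card (T `` {p y})"
      using assms child_in_nbrs[of y] child_in_nbrs[of z] by (intro card_mono finite_nbrs) auto
    then show False using True assms \<open>y \<noteq> z\<close> by (simp add: degree_in_def)
  next
    case False
    have "card {y, z, p (p y)} \<le> card (T `` {p y})"
      using assms child_in_nbrs[of y] child_in_nbrs[of z] parent_in_nbrs[of "p y"] parent_in False
      by (intro card_mono finite_nbrs) auto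
    moreover have "p (p y) \<noteq> y" "p (p y) \<noteq> z"
      using child_neq_grandparent[of y] child_neq_grandparent[of z] assms False by auto
    ultimately show False using False assms \<open>y \<noteq> z\<close> by (simp add: degree_in_def)
  qed
qed

end

text \<open>The parent arcs with their reverses form a tree inside \<open>T\<close>; having as many
  arcs as \<open>T\<close>, it is all of \<open>T\<close>.\<close>

lemma spanning_tree_on_rooted:
  assumes "finite V" "spanning_tree_on V T" "u \<in> V"
  obtains p d where "rooted_tree V T u p d"
proof -
  have T: "T \<subseteq> V \<times> V" "sym T" "connected_on V T" "card T = 2 * (card V - 1)"
    using assms by (auto simp: spanning_tree_on_def)
  obtain p and d :: "'a \<Rightarrow> nat"
    where p: "\<And>x. x \<in> V \<Longrightarrow> x \<noteq> u \<Longrightarrow> p x \<in> V \<and> (x, p x) \<in> T \<and> d (p x) < d x"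
    using connected_on_parent[OF T(1,3) assms(3)] by blast
  let ?P = "(\<lambda>x. (x, p x)) ` (V - {u})"
  interpret S: rooted_tree V "?P \<union> ?P\<inverse>" u p d
    using assms p by unfold_locales auto
  have "?P \<union> ?P\<inverse> \<subseteq> T" using p \<open>sym T\<close> by (auto dest: symD)
  moreover have "finite T" using T(1) assms(1) finite_subset by blast
  ultimately have "?P \<union> ?P\<inverse> = T"
    using S.card_tree T(4) by (intro card_subset_eq) auto
  then show ?thesis using that S.rooted_tree_axioms by simp
qed

lemma connected_on_spanning_tree:
  assumes "finite V" "V \<noteq> {}" "E \<subseteq> V \<times> V" "sym E" "connected_on V E"
  obtains T where "spanning_tree_on V T" "T \<subseteq> E"
proof -
  obtain u where "u \<in> V" using assms by blast
  obtain p and d :: "'a \<Rightarrow> nat"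
    where p: "\<And>x. x \<in> V \<Longrightarrow> x \<noteq> u \<Longrightarrow> p x \<in> V \<and> (x, p x) \<in> E \<and> d (p x) < d x"
    using connected_on_parent[OF assms(3,5) \<open>u \<in> V\<close>] by blast
  let ?P = "(\<lambda>x. (x, p x)) ` (V - {u})"
  interpret S: rooted_tree V "?P \<union> ?P\<inverse>" u p d
    using assms p \<open>u \<in> V\<close> by unfold_locales auto
  have "?P \<union> ?P\<inverse> \<subseteq> E" using p \<open>sym E\<close> by (auto dest: symD)
  then show ?thesis using that S.spanning_tree by blast
qed

lemma connected_on_card_ge:
  assumes "finite V" "E \<subseteq> V \<times> V" "sym E" "connected_on V E"
  shows "card E \<ge> 2 * (card V - 1)"
proof (cases "V = {}")
  case False
  have "finite E" using assms finite_subset by blast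
  then show ?thesis
    using connected_on_spanning_tree[OF assms(1) False assms(2-4)]
    by (metis card_mono spanning_tree_on_def)
qed simp

section \<open>Edge exchange across the cut below a vertex\<close>

definition exchange :: "'a rel \<Rightarrow> 'a \<Rightarrow> 'a \<Rightarrow> 'a \<Rightarrow> 'a \<Rightarrow> 'a rel" where
  "exchange T w c a b = T - {(w, c), (c, w)} \<union> {(a, b), (b, a)}"

context rooted_tree
begin

context
  fixes w a b
  assumes w: "w \<in> V" "w \<noteq> u" and a: "a \<in> desc w" and b: "b \<in> V" "b \<notin> desc w" "b \<noteq> p w"
begin

lemma exchange_new: "(a, b) \<notin> T" "(b, a) \<notin> T"
  using desc_exit a b sym_tree by (blast dest: symD)+

lemma exchange_old: "(w, p w) \<in> T" "(p w, w) \<in> T" "w \<noteq> p w"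
  using w depth_parent by (force simp: tree_iff up_iff)+

lemma exchange_neq: "a \<noteq> b"
  using a b by blast

text \<open>Both sides of the cut stay connected, the new edge joins them again, and the number of
  arcs is unchanged.\<close>

lemma exchange_spanning_tree: "spanning_tree_on V (exchange T w (p w) a b)"
proof -
  let ?T = "exchange T w (p w) a b"
  have aV: "a \<in> V" using a by (simp add: desc_def)
  have sym: "sym ?T"
    using sym_tree unfolding exchange_def sym_def by blast
  have sub: "?T \<subseteq> V \<times> V"
    using tree_subset aV b(1) unfolding exchange_def by blast
  have irr: "irrefl ?T"
    using irrefl_tree exchange_neq unfolding exchange_def irrefl_def by blast
  have "{(x, y) \<in> T. x \<in> desc w \<and> y \<in> desc w} \<subseteq> ?T"
    using parent_notin_desc w unfolding exchange_def by blast
  then have inside: "(x, w) \<in> ?T\<^sup>*" if "x \<in> desc w" for x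
    using desc_path[OF that] rtrancl_mono by blast
  have "{(x, y) \<in> T. x \<notin> desc w \<and> y \<notin> desc w} \<subseteq> ?T"
    using desc_self w unfolding exchange_def by blast
  then have outside: "(x, u) \<in> ?T\<^sup>*" if "x \<in> V" "x \<notin> desc w" for x
    using not_desc_path[OF that] rtrancl_mono by blast
  have "(w, a) \<in> ?T\<^sup>*" using inside[OF a] symD[OF sym_rtrancl[OF sym]] by blast
  moreover have "(a, b) \<in> ?T" by (simp add: exchange_def)
  ultimately have "(w, u) \<in> ?T\<^sup>*"
    using outside[OF b(1,2)] by (auto intro: rtrancl_trans converse_rtrancl_into_rtrancl)
  then have conn: "connected_on V ?T"
    using inside outside rtrancl_trans[of _ w ?T u]
    by (intro connected_on_from_root[OF sym, of _ u]) blast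
  have "card (T - {(w, p w), (p w, w)}) = card T - 2"
    using exchange_old finite_T by (subst card_Diff_subset) auto
  moreover have "card T \<ge> 2"
    using exchange_old finite_T card_mono[of T "{(w, p w), (p w, w)}"] by simp
  moreover have "card ?T = card (T - {(w, p w), (p w, w)}) + card {(a, b), (b, a)}"
    unfolding exchange_def using exchange_new finite_T by (intro card_Un_disjoint) auto
  ultimately have "card ?T = card T" using exchange_neq by simp
  then show ?thesis
    unfolding spanning_tree_on_def using sub sym irr conn card_tree by simp
qed

text \<open>The subtraction never truncates, as \<open>w\<close> and \<open>p w\<close> are ends of
  a tree edge. A vertex in both sets, such as \<open>w\<close> when \<open>a = w\<close>, keeps its
  degree.\<close>

lemma exchange_degree:
  "degree_in (exchange T w (p w) a b) x =
    degree_in T x - (if x \<in> {w, p w} then 1 else 0) + (if x \<in> {a, b} then 1 else 0)"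
proof -
  let ?R = "if x = w then {p w} else if x = p w then {w} else {}"
  let ?A = "if x = a then {b} else if x = b then {a} else {}"
  have "exchange T w (p w) a b `` {x} = (T `` {x} - ?R) \<union> ?A"
    using exchange_old exchange_neq by (auto simp: exchange_def split: if_splits)
  moreover have "card (T `` {x} - ?R \<union> ?A) = card (T `` {x} - ?R) + card ?A"
    using exchange_new finite_nbrs[of x] by (intro card_Un_disjoint) (auto split: if_splits)
  moreover have "card (T `` {x} - ?R) = card (T `` {x}) - card ?R"
    using exchange_old by (intro card_Diff_subset) auto
  ultimately show ?thesis by (auto simp: degree_in_def)
qed

end

end

section \<open>Counting leaves and branch vertices by degree sums\<close>

lemma sum_degrees:
  assumes "finite V" "T \<subseteq> V \<times> V"
  shows "(\<Sum>x\<in>V. degree_in T x) = card T"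
proof -
  have "finite T" using assms finite_subset by blast
  then have "card (Sigma V (\<lambda>x. T `` {x})) = (\<Sum>x\<in>V. degree_in T x)"
    using assms(1) by (simp add: degree_in_def finite_Image)
  moreover have "Sigma V (\<lambda>x. T `` {x}) = T" using assms(2) by auto
  ultimately show ?thesis by simp
qed

lemma degree_pos:
  assumes "finite V" "spanning_tree_on V T" "card V \<ge> 2" "x \<in> V"
  shows "degree_in T x \<ge> 1"
proof -
  have "V \<noteq> {x}" using assms by auto
  then obtain y where y: "y \<in> V" "y \<noteq> x" using assms by blast
  then have "(x, y) \<in> T\<^sup>*"
    using assms by (auto simp: spanning_tree_on_def connected_on_def)
  then have "T `` {x} \<noteq> {}" using y by (auto elim: converse_rtranclE)
  moreover have "finite T"
    using assms finite_subset[of T "V \<times> V"] by (simp add: spanning_tree_on_def)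
  ultimately show ?thesis
    by (simp add: degree_in_def Suc_le_eq card_gt_0_iff finite_Image)
qed

text \<open>Handshake count, stated over the integers because leaves contribute
  \<open>-1\<close>.\<close>

lemma sum_degree_excess:
  assumes "finite V" "spanning_tree_on V T" "card V \<ge> 2"
  shows "(\<Sum>x\<in>V. int (degree_in T x) - 2) = - 2"
proof -
  have "(\<Sum>x\<in>V. int (degree_in T x) - 2) = int (\<Sum>x\<in>V. degree_in T x) - 2 * int (card V)"
    by (simp add: sum_subtractf)
  also have "(\<Sum>x\<in>V. degree_in T x) = 2 * (card V - 1)"
    using sum_degrees[of V T] assms by (simp add: spanning_tree_on_def)
  finally show ?thesis using assms by linarith
qed

text \<open>In the sum of \<open>sum_degree_excess\<close>, a leaf counts \<open>-1\<close>, a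
  vertex of degree two counts \<open>0\<close> and a branch vertex at least
  \<open>1\<close>.\<close>

lemma card_leaves_ge:
  assumes "finite V" "spanning_tree_on V T" "card V \<ge> 2"
  shows "card (leaves V T) \<ge> card (branches V T) + 2"
proof -
  have "int (card (branches V T)) - int (card (leaves V T)) =
      (\<Sum>x\<in>V. (if degree_in T x \<ge> 3 then 1 else 0) - (if degree_in T x = 1 then 1 else 0))"
    using assms(1) by (simp add: sum_subtractf sum.If_cases leaves_def branches_def Int_def)
  also have "\<dots> \<le> (\<Sum>x\<in>V. int (degree_in T x) - 2)"
    using degree_pos[OF assms] by (intro sum_mono) force
  finally show ?thesis using sum_degree_excess[OF assms] by linarith
qed

text \<open>Without branch vertices only the leaves contribute to the excess \<open>-2\<close>, so
  there would be exactly two of them.\<close>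

lemma branches_nonempty:
  assumes "finite V" "spanning_tree_on V T" "card (leaves V T) \<ge> 3"
  shows "branches V T \<noteq> {}"
proof
  assume empty: "branches V T = {}"
  have "card (leaves V T) \<le> card V" using assms(1) by (intro card_mono) (auto simp: leaves_def)
  then have V: "card V \<ge> 2" using assms by simp
  have "- int (card (leaves V T)) = (\<Sum>x\<in>V. - (if degree_in T x = 1 then 1 else 0))"
    using assms(1) by (simp add: sum_negf sum.If_cases leaves_def Int_def)
  also have "\<dots> = (\<Sum>x\<in>V. int (degree_in T x) - 2)"
  proof (rule sum.cong)
    fix x assume x: "x \<in> V"
    then have "degree_in T x < 3" using empty by (auto simp: branches_def)
    then show "- (if degree_in T x = 1 then 1 else 0) = int (degree_in T x) - 2"
      using degree_pos[OF assms(1,2) V x] by auto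
  qed simp
  finally show False using sum_degree_excess[OF assms(1,2) V] assms(3) by linarith
qed

section \<open>Minimal trees\<close>

definition leaf_minimal :: "'a set \<Rightarrow> 'a rel \<Rightarrow> 'a rel \<Rightarrow> bool" where
  "leaf_minimal V E T \<longleftrightarrow> spanning_tree_on V T \<and> T \<subseteq> E \<and>
    (\<forall>T'. spanning_tree_on V T' \<and> T' \<subseteq> E \<longrightarrow> card (leaves V T) \<le> card (leaves V T'))"

definition leaf_branch_minimal :: "'a set \<Rightarrow> 'a rel \<Rightarrow> 'a rel \<Rightarrow> bool" where
  "leaf_branch_minimal V E T \<longleftrightarrow> leaf_minimal V E T \<and>
    (\<forall>T'. leaf_minimal V E T' \<longrightarrow> card (branches V T) \<le> card (branches V T'))"

lemma exchange_subset:
  "sym E \<Longrightarrow> T \<subseteq> E \<Longrightarrow> (a, b) \<in> E \<Longrightarrow> exchange T w c a b \<subseteq> E"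
  by (auto simp: exchange_def dest: symD)

lemma leaf_minimal_le:
  "leaf_minimal V E T \<Longrightarrow> spanning_tree_on V T' \<Longrightarrow> T' \<subseteq> E \<Longrightarrow>
    card (leaves V T) \<le> card (leaves V T')"
  by (simp add: leaf_minimal_def)

lemma leaf_minimal_eq:
  "leaf_minimal V E T \<Longrightarrow> spanning_tree_on V T' \<Longrightarrow> T' \<subseteq> E \<Longrightarrow>
    card (leaves V T') \<le> card (leaves V T) \<Longrightarrow> leaf_minimal V E T'"
  by (force simp: leaf_minimal_def)

lemma finite_leaves: "finite V \<Longrightarrow> finite (leaves V T)"
  by (simp add: leaves_def)

lemma finite_branches: "finite V \<Longrightarrow> finite (branches V T)"
  by (simp add: branches_def)

section \<open>Exchange arguments in minimal trees\<close>

context rooted_tree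
begin

text \<open>Otherwise all ancestors of \<open>v\<close> have degree at most two, so they are closed
  under tree adjacency and exhaust \<open>V\<close>. Every vertex except \<open>u\<close> and
  \<open>v\<close> then has both a parent and a child, which leaves only two leaves.\<close>

lemma branch_ancestor:
  assumes "u \<in> leaves V T" "v \<in> leaves V T" "v \<noteq> u" "card (leaves V T) \<ge> 3"
  obtains c where "c \<in> branches V T" "v \<in> desc c"
proof (rule ccontr)
  assume no: "\<not> thesis"
  have v: "v \<in> V" "degree_in T v = 1" and u: "degree_in T u = 1"
    using assms by (auto simp: leaves_def)
  have small: "degree_in T c \<le> 2" if "v \<in> desc c" "c \<in> V" for c
    using no that \<open>\<And>c. c \<in> branches V T \<Longrightarrow> v \<in> desc c \<Longrightarrow> thesis\<close>
    by (force simp: branches_def)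
  \<comment> \<open>Going up is immediate. Going down from \<open>c\<close>, the degree bound allows
    only one child, and \<open>v\<close> lies below it.\<close>
  have closed: "v \<in> desc b" if vc: "v \<in> desc c" "(c, b) \<in> T" for b c
  proof (cases "(c, b) \<in> up")
    case True
    then show ?thesis using vc by (auto simp: desc_def)
  next
    case False
    then have b: "b \<in> V" "b \<noteq> u" "p b = c"
      using vc by (auto simp: tree_iff up_iff)
    have "c \<in> V" using b parent_in by auto
    have "v \<noteq> c"
    proof
      assume "v = c"
      then have "degree_in T v \<ge> 2" using degree_inner[of b] b assms(3) by simp
      then show False using v by simp
    qed
    then obtain w where w: "w \<in> V" "w \<noteq> u" "p w = c" "v \<in> desc w"
      using desc_child[OF vc(1)] by blast
    have "w = b"
      by (rule unique_child) (use w b u small[OF vc(1) \<open>c \<in> V\<close>] in auto)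
    then show ?thesis using w by simp
  qed
  have all: "v \<in> desc x" if "x \<in> V" for x
  proof -
    have "(v, x) \<in> T\<^sup>*" using connected_tree v that by (simp add: connected_on_def)
    then show ?thesis
      by (induction rule: rtrancl_induct) (use closed desc_self v in auto)
  qed
  have "leaves V T \<subseteq> {u, v}"
  proof
    fix x assume x: "x \<in> leaves V T"
    show "x \<in> {u, v}"
    proof (rule ccontr)
      assume "x \<notin> {u, v}"
      moreover have "x \<in> V" using x by (simp add: leaves_def)
      ultimately obtain w where "w \<in> V" "w \<noteq> u" "p w = x"
        using desc_child[OF all[of x]] by blast
      then have "degree_in T x \<ge> 2"
        using degree_inner[of w] \<open>x \<notin> {u, v}\<close> by simp
      then show False using x by (simp add: leaves_def)
    qed
  qed
  then have "card (leaves V T) \<le> card {u, v}" by (rule card_mono[rotated]) simp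
  also have "\<dots> \<le> 2" by (simp add: card_insert_if)
  finally show False using assms(4) by simp
qed

lemma root_leaf_nonadjacent:
  assumes "sym E" "leaf_minimal V E T" "card (leaves V T) \<ge> 3"
    and "u \<in> leaves V T" "v \<in> leaves V T" "v \<noteq> u"
  shows "(v, u) \<notin> E"
proof
  assume vu: "(v, u) \<in> E"
  obtain c where c: "c \<in> branches V T" "v \<in> desc c"
    using branch_ancestor assms by metis
  have degs: "degree_in T v = 1" "degree_in T u = 1" "degree_in T c \<ge> 3"
    using assms c by (auto simp: leaves_def branches_def)
  then have neq: "v \<noteq> c" "u \<noteq> c" by auto
  then obtain w where w: "w \<in> V" "w \<noteq> u" "p w = c" "v \<in> desc w"
    using desc_child[OF c(2)] by blast
  \<comment> \<open>The cycle closed by the edge between \<open>v\<close> and \<open>u\<close>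
    passes through \<open>w\<close> and \<open>c\<close>, so the edge between these two can be given
    up.\<close>
  define T' where "T' = exchange T w c v u"
  have tree: "spanning_tree_on V T'"
    unfolding T'_def using exchange_spanning_tree[of w v u] w neq root_in root_notin_desc by auto
  have deg: "degree_in T' x =
      degree_in T x - (if x \<in> {w, c} then 1 else 0) + (if x \<in> {v, u} then 1 else 0)" for x
    unfolding T'_def using exchange_degree[of w v u x] w neq root_in root_notin_desc by auto
  \<comment> \<open>\<open>u\<close> gains an edge and \<open>c\<close> keeps degree at least two.
    Only \<open>w\<close> may become a leaf; if \<open>w = v\<close>, it remains one.\<close>
  have "leaves V T' \<subseteq> insert w (leaves V T - {u, v})"
  proof
    fix x assume "x \<in> leaves V T'"
    then have "x \<in> V" and x1: "degree_in T x - (if x \<in> {w, c} then 1 else 0) +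
        (if x \<in> {v, u} then 1 else 0) = 1"
      by (simp_all add: leaves_def deg del: One_nat_def)
    then have "x \<noteq> c" "x \<noteq> w \<longrightarrow> x \<noteq> u \<and> x \<noteq> v" using degs neq by auto
    then show "x \<in> insert w (leaves V T - {u, v})"
      using x1 \<open>x \<in> V\<close> by (auto simp: leaves_def)
  qed
  then have "card (leaves V T') \<le> card (insert w (leaves V T - {u, v}))"
    by (intro card_mono) (auto simp: finite_leaves finite_V)
  also have "\<dots> \<le> Suc (card (leaves V T - {u, v}))"
    by (simp add: card_insert_if finite_leaves finite_V)
  also have "card (leaves V T - {u, v}) = card (leaves V T) - 2"
    using assms by (subst card_Diff_subset) auto
  finally have "card (leaves V T') < card (leaves V T)" using assms(3) by simp
  moreover have "T' \<subseteq> E"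
    unfolding T'_def using assms vu by (intro exchange_subset) (auto simp: leaf_minimal_def)
  ultimately show False
    using leaf_minimal_le[OF assms(2) tree] by simp
qed

text \<open>The exchange raises \<open>u\<close> to degree two, preserves the degree of
  \<open>x\<close> and lowers that of \<open>p x\<close> by one. If \<open>p x\<close> had degree at
  least three, a leaf would be saved; so \<open>p x\<close> replaces \<open>u\<close> as a leaf, and
  independence of leaves can later be applied to it in the new tree.\<close>

lemma root_flip:
  assumes "sym E" "leaf_minimal V E T" "u \<in> leaves V T"
    and x: "x \<in> V" "x \<noteq> u" "p x \<noteq> u" "(x, u) \<in> E"
  shows "degree_in T (p x) = 2"
    and "\<exists>T'. leaf_minimal V E T' \<and> leaves V T' = insert (p x) (leaves V T - {u})"
proof -
  let ?T = "exchange T x (p x) x u"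
  have px: "p x \<in> V" "x \<noteq> p x" using x parent_in depth_parent[of x] by auto
  have u: "degree_in T u = 1" using assms by (simp add: leaves_def)
  have tree: "spanning_tree_on V ?T"
    using x root_in root_notin_desc desc_self by (intro exchange_spanning_tree) auto
  have deg: "degree_in ?T y =
      degree_in T y - (if y \<in> {x, p x} then 1 else 0) + (if y \<in> {x, u} then 1 else 0)" for y
    using x root_in root_notin_desc desc_self by (intro exchange_degree) auto
  have sub: "?T \<subseteq> E"
    using assms by (intro exchange_subset) (auto simp: leaf_minimal_def)
  have ge2: "degree_in T (p x) \<ge> 2" using degree_inner x by blast
  have dx: "degree_in T x \<ge> 1"
    using parent_in_nbrs[OF x(1,2)] finite_nbrs[of x]
    by (metis One_nat_def Suc_le_eq card_gt_0_iff degree_in_def empty_iff)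
  show two: "degree_in T (p x) = 2"
  proof (rule ccontr)
    assume "degree_in T (p x) \<noteq> 2"
    then have "leaves V ?T \<subseteq> leaves V T - {u}"
      using ge2 u dx x px by (auto simp: leaves_def deg)
    then have "card (leaves V ?T) \<le> card (leaves V T - {u})"
      by (intro card_mono) (auto simp: finite_leaves finite_V)
    also have "\<dots> < card (leaves V T)"
      using assms(3) by (intro card_Diff1_less finite_leaves finite_V)
    finally show False using leaf_minimal_le[OF assms(2) tree sub] by simp
  qed
  have eq: "leaves V ?T = insert (p x) (leaves V T - {u})"
    using two u dx x px by (auto simp: leaves_def deg)
  moreover have "card (insert (p x) (leaves V T - {u})) = card (leaves V T)"
    using two card_Suc_Diff1[OF finite_leaves[OF finite_V] assms(3)] finite_leaves[OF finite_V]
    by (subst card_insert_disjoint) (auto simp: leaves_def)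
  ultimately have "leaf_minimal V E ?T"
    using leaf_minimal_eq[OF assms(2) tree sub] by simp
  then show "\<exists>T'. leaf_minimal V E T' \<and> leaves V T' = insert (p x) (leaves V T - {u})"
    using eq by blast
qed

text \<open>A path out of \<open>desc w\<close> must leave it by an arc starting at
  \<open>w\<close>. This bounds descendants in an exchanged tree without knowing its parent
  function.\<close>

lemma avoiding_path_not_desc:
  assumes "(x, u) \<in> {(a, b) \<in> T. a \<noteq> w}\<^sup>*" "w \<noteq> u"
  shows "x \<notin> desc w"
proof
  assume "x \<in> desc w"
  have "y \<in> desc w" if "(x, y) \<in> {(a, b) \<in> T. a \<noteq> w}\<^sup>*" for y
    using that
  proof (induction rule: rtrancl_induct)
    case (step y z)
    then show ?case using desc_exit[of y z w] by auto
  qed fact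
  then show False using root_notin_desc assms by blast
qed

text \<open>The leg through \<open>w\<close> is cut off at \<open>c\<close> and hung onto
  \<open>y\<close> by its end \<open>v\<close>. The last conclusion covers every rooting of
  \<open>T'\<close> at \<open>u\<close>, since the exchange does not supply a parent
  function.\<close>

lemma leg_move:
  assumes "sym E" "leaf_branch_minimal V E T" "u \<in> leaves V T"
    and c: "c \<in> branches V T" "branches V T \<inter> desc c \<subseteq> {c}"
    and v: "v \<in> leaves V T" "v \<in> desc c"
    and y: "y \<in> branches V T" "y \<noteq> c" "(v, y) \<in> E"
  obtains T' where "leaf_branch_minimal V E T'" "u \<in> leaves V T'" "c \<in> branches V T'"
    "\<And>p' d'. rooted_tree V T' u p' d' \<Longrightarrow> rooted_tree.desc V u p' c \<subset> desc c"
proof -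
  have degs: "degree_in T v = 1" "degree_in T u = 1" "degree_in T c \<ge> 3" "degree_in T y \<ge> 3"
    using assms by (auto simp: leaves_def branches_def)
  then have neq: "v \<noteq> c" "u \<noteq> c" "v \<noteq> y" "u \<noteq> y" by auto
  have inV: "v \<in> V" "c \<in> V" "y \<in> V" using assms by (auto simp: leaves_def branches_def)
  have "v \<noteq> u" using v(2) root_notin_desc[of c] neq(2) by metis
  obtain w where w: "w \<in> V" "w \<noteq> u" "p w = c" "v \<in> desc w"
    using desc_child[OF v(2)] neq(1) by blast
  have "w \<in> desc c" using child_in_desc w by blast
  have "w \<noteq> c" using depth_parent[of w] w by auto
  have ynd: "y \<notin> desc c" using c y by blast
  then have ynw: "y \<notin> desc w" "y \<noteq> w" using \<open>w \<in> desc c\<close> desc_trans by blast+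
  define T' where "T' = exchange T w c v y"
  have tree: "spanning_tree_on V T'"
    unfolding T'_def using exchange_spanning_tree[of w v y] w ynw y(2) inV by auto
  have deg: "degree_in T' x =
      degree_in T x - (if x \<in> {w, c} then 1 else 0) + (if x \<in> {v, y} then 1 else 0)" for x
    unfolding T'_def using exchange_degree[of w v y x] w ynw y(2) inV by auto
  have sub: "T' \<subseteq> E"
    unfolding T'_def using assms by (intro exchange_subset) (auto simp: leaf_minimal_def leaf_branch_minimal_def)
  have min: "leaf_minimal V E T" using assms by (simp add: leaf_branch_minimal_def)
  \<comment> \<open>\<open>c\<close> keeps degree at least two, so \<open>w\<close> is the only
    possible new leaf, in place of \<open>v\<close>.\<close>
  have "leaves V T' \<subseteq> insert w (leaves V T - {v})"
  proof
    fix x assume "x \<in> leaves V T'"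
    then have "x \<in> V" and x1: "degree_in T x - (if x \<in> {w, c} then 1 else 0) +
        (if x \<in> {v, y} then 1 else 0) = 1"
      by (simp_all add: leaves_def deg del: One_nat_def)
    then have "x \<noteq> c" "x \<noteq> y" "x \<noteq> w \<longrightarrow> x \<noteq> v" using degs neq y(2) ynw(2) by auto
    then show "x \<in> insert w (leaves V T - {v})"
      using x1 \<open>x \<in> V\<close> by (auto simp: leaves_def)
  qed
  then have "card (leaves V T') \<le> card (insert w (leaves V T - {v}))"
    by (intro card_mono) (auto simp: finite_leaves finite_V)
  also have "\<dots> \<le> Suc (card (leaves V T - {v}))"
    by (simp add: card_insert_if finite_leaves finite_V)
  also have "\<dots> = card (leaves V T)"
    using v finite_leaves[OF finite_V] by (intro card_Suc_Diff1)
  finally have min': "leaf_minimal V E T'"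
    using leaf_minimal_eq[OF min tree sub] by simp
  \<comment> \<open>Only \<open>v\<close> and \<open>y\<close> can gain degree: \<open>v\<close>
    reaches at most two, and \<open>y\<close> was a branch vertex before.\<close>
  have B_sub: "branches V T' \<subseteq> branches V T"
  proof
    fix x assume "x \<in> branches V T'"
    then have "x \<in> V" and x3: "degree_in T x - (if x \<in> {w, c} then 1 else 0) +
        (if x \<in> {v, y} then 1 else 0) \<ge> 3"
      by (simp_all add: branches_def deg)
    then have "x \<noteq> v" using degs neq by auto
    then show "x \<in> branches V T"
      using x3 \<open>x \<in> V\<close> y(1) by (cases "x = y") (auto simp: branches_def)
  qed
  have "card (branches V T) \<le> card (branches V T')"
    using assms(2) min' by (simp add: leaf_branch_minimal_def)
  \<comment> \<open>Hence \<open>c\<close> is still a branch vertex: had its degree been exactly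
    three, \<open>T'\<close> would have fewer branch vertices than \<open>T\<close>.\<close>
  then have B_eq: "branches V T' = branches V T"
    using B_sub finite_branches[OF finite_V] by (metis card_seteq)
  show thesis
  proof
    show "leaf_branch_minimal V E T'"
      using assms(2) min' B_eq by (simp add: leaf_branch_minimal_def)
    show "u \<in> leaves V T'"
      using degs neq w(2) root_in \<open>v \<noteq> u\<close> by (simp add: leaves_def deg)
    show "c \<in> branches V T'" using B_eq c by simp
    fix p' d' assume "rooted_tree V T' u p' d'"
    then interpret S: rooted_tree V T' u p' d' .
    \<comment> \<open>Vertices that reach \<open>u\<close> along \<open>?A\<close> are not below
      \<open>c\<close> in the new tree. This applies to all vertices outside \<open>desc c\<close>,
      and also to \<open>w\<close>, by way of \<open>v\<close> and \<open>y\<close>.\<close>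
    let ?A = "{(a, b) \<in> T'. a \<noteq> c}"
    have "{(a, b) \<in> T. a \<notin> desc c \<and> b \<notin> desc c} \<subseteq> ?A"
      using \<open>w \<in> desc c\<close> desc_self[OF inV(2)] unfolding T'_def exchange_def by blast
    then have out: "(x, u) \<in> ?A\<^sup>*" if "x \<in> V" "x \<notin> desc c" for x
      using not_desc_path[OF that] rtrancl_mono by blast
    have "c \<notin> desc w" using parent_notin_desc w by blast
    \<comment> \<open>\<open>desc_path\<close> leads from \<open>v\<close> to \<open>w\<close>, but
      the reverse is needed. As \<open>?A\<close> need not be symmetric, the path is reversed inside
      its symmetric part.\<close>
    then have "{(a, b) \<in> T. a \<in> desc w \<and> b \<in> desc w} \<subseteq> {(a, b). (a, b) \<in> ?A \<and> (b, a) \<in> ?A}"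
      using sym_tree w unfolding T'_def exchange_def by (auto dest: symD)
    then have "(v, w) \<in> {(a, b). (a, b) \<in> ?A \<and> (b, a) \<in> ?A}\<^sup>*"
      using desc_path[OF w(4)] rtrancl_mono by blast
    then have "(w, v) \<in> {(a, b). (a, b) \<in> ?A \<and> (b, a) \<in> ?A}\<^sup>*"
      by (rule symD[OF sym_rtrancl, rotated]) (auto simp: sym_def)
    moreover have "{(a, b). (a, b) \<in> ?A \<and> (b, a) \<in> ?A} \<subseteq> ?A" by blast
    ultimately have "(w, v) \<in> ?A\<^sup>*" using rtrancl_mono by blast
    moreover have "(v, y) \<in> ?A" using neq by (simp add: T'_def exchange_def)
    ultimately have "(w, u) \<in> ?A\<^sup>*"
      using out[OF inV(3) ynd] by (meson rtrancl.rtrancl_into_rtrancl rtrancl_trans)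
    then have "w \<notin> S.desc c" using S.avoiding_path_not_desc neq by blast
    moreover have "S.desc c \<subseteq> desc c"
    proof
      fix x assume x: "x \<in> S.desc c"
      then have "x \<in> V" by (simp add: S.desc_def)
      then show "x \<in> desc c" using x out S.avoiding_path_not_desc neq by blast
    qed
    ultimately show "S.desc c \<subset> desc c" using \<open>w \<in> desc c\<close> by blast
  qed
qed

text \<open>A descendant of greatest depth has no child, so its parent is its only
  neighbour.\<close>

lemma deepest_desc_leaf:
  assumes "c \<in> V" "c \<noteq> u"
  obtains v where "v \<in> desc c" "v \<in> leaves V T"
proof -
  have "desc c \<noteq> {}" using desc_self assms by blast
  then obtain v where v: "v \<in> desc c" "d v = Max (d ` desc c)"
    using finite_desc[of c] obtains_MAX by metis
  then have deepest: "d x \<le> d v" if "x \<in> desc c" for x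
    using that finite_desc[of c] by simp
  have vV: "v \<in> V" "v \<noteq> u"
    using v(1) root_notin_desc[OF assms(2)] by (auto simp: desc_def)
  have "p y \<noteq> v" if "y \<in> V - {u}" for y
  proof
    assume py: "p y = v"
    then have "y \<in> desc c" using that v(1) child_in_desc[of y] desc_trans by blast
    then have "d y \<le> d (p y)" using deepest py by blast
    then show False using depth_parent[of y] that by auto
  qed
  then have "T `` {v} = {p v}" using nbrs_eq[OF vV] by blast
  then show thesis using that v(1) vV(1) by (simp add: leaves_def degree_in_def)
qed

end

section \<open>Extremal choice and the degree sum bound\<close>

lemma leaf_branch_minimal_exists:
  assumes "spanning_tree_on V T\<^sub>0" "T\<^sub>0 \<subseteq> E"
  obtains T where "leaf_branch_minimal V E T"
proof -
  have "\<exists>T. leaf_minimal V E T"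
    using ex_has_least_nat[of "\<lambda>T. spanning_tree_on V T \<and> T \<subseteq> E" T\<^sub>0 "\<lambda>T. card (leaves V T)"] assms
    by (auto simp: leaf_minimal_def)
  then obtain T\<^sub>1 where "leaf_minimal V E T\<^sub>1" ..
  then show ?thesis
    using ex_has_least_nat[of "leaf_minimal V E" T\<^sub>1 "\<lambda>T. card (branches V T)"] that
    by (auto simp: leaf_branch_minimal_def)
qed

text \<open>Any leaf can be made the root, so \<open>root_leaf_nonadjacent\<close> covers all pairs
  of leaves.\<close>

lemma leaf_minimal_independent:
  assumes "finite V" "sym E" "leaf_minimal V E T" "card (leaves V T) \<ge> 3"
    and "a \<in> leaves V T" "b \<in> leaves V T" "a \<noteq> b"
  shows "(a, b) \<notin> E"
proof -
  have "spanning_tree_on V T" "b \<in> V"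
    using assms by (simp_all add: leaves_def leaf_minimal_def)
  then obtain p d where "rooted_tree V T b p d"
    by (rule spanning_tree_on_rooted[OF assms(1)])
  then interpret rooted_tree V T b p d .
  show ?thesis
    using root_leaf_nonadjacent[OF assms(2,3,4,6,5,7)] .
qed

text \<open>With as few descendants of \<open>c\<close> as possible, any leaf below \<open>c\<close>
  serves as \<open>v\<close>: an edge from it to another branch vertex would allow
  \<open>leg_move\<close>.\<close>

lemma private_branch_leaf:
  assumes "finite V" "sym E" "leaf_branch_minimal V E T\<^sub>0" "card (leaves V T\<^sub>0) \<ge> 3"
  obtains T u p d c v where "leaf_branch_minimal V E T" "rooted_tree V T u p d"
    "u \<in> leaves V T" "v \<in> leaves V T" "v \<noteq> u" "c \<in> branches V T"
    "\<And>y. y \<in> branches V T \<Longrightarrow> y \<noteq> c \<Longrightarrow> (v, y) \<notin> E"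
proof -
  \<comment> \<open>The parent and depth functions belong to the choice because \<open>desc\<close>
    depends on the rooting.\<close>
  define Q where "Q = (\<lambda>(T, u, p, d, c). leaf_branch_minimal V E T \<and> rooted_tree V T u p d \<and>
    u \<in> leaves V T \<and> c \<in> branches V T)"
  define m where "m = (\<lambda>(T :: 'a rel, u :: 'a, p, d :: 'a \<Rightarrow> nat, c). card (rooted_tree.desc V u p c))"
  have T0: "spanning_tree_on V T\<^sub>0"
    using assms by (simp add: leaf_branch_minimal_def leaf_minimal_def)
  obtain c\<^sub>0 where "c\<^sub>0 \<in> branches V T\<^sub>0" using branches_nonempty assms T0 by blast
  moreover obtain u\<^sub>0 where u0: "u\<^sub>0 \<in> leaves V T\<^sub>0"
    using assms(4) by (cases "leaves V T\<^sub>0 = {}") auto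
  moreover have "u\<^sub>0 \<in> V" using u0 by (simp add: leaves_def)
  then obtain p\<^sub>0 d\<^sub>0 where "rooted_tree V T\<^sub>0 u\<^sub>0 p\<^sub>0 d\<^sub>0"
    by (rule spanning_tree_on_rooted[OF assms(1) T0])
  ultimately have "Q (T\<^sub>0, u\<^sub>0, p\<^sub>0, d\<^sub>0, c\<^sub>0)" using assms(3) by (simp add: Q_def)
  from ex_has_least_nat[of Q, OF this, of m]
  obtain z where z: "Q z" "\<And>z'. Q z' \<Longrightarrow> m z \<le> m z'"
    by blast
  obtain T u p d c where zz: "z = (T, u, p, d, c)" by (cases z)
  have T: "leaf_branch_minimal V E T" "rooted_tree V T u p d" "u \<in> leaves V T" "c \<in> branches V T"
    using z(1) by (auto simp: zz Q_def)
  interpret rooted_tree V T u p d by fact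
  have least: "card (desc c) \<le> card (rooted_tree.desc V u' p' c')"
    if "leaf_branch_minimal V E T'" "rooted_tree V T' u' p' d'" "u' \<in> leaves V T'"
      "c' \<in> branches V T'" for T' u' p' d' c'
    using z(2)[of "(T', u', p', d', c')"] that by (simp add: zz Q_def m_def)
  have c: "c \<in> V" "c \<noteq> u" using T by (auto simp: leaves_def branches_def)
  have only: "branches V T \<inter> desc c \<subseteq> {c}"
  proof (rule ccontr)
    assume "\<not> branches V T \<inter> desc c \<subseteq> {c}"
    then obtain y where y: "y \<in> branches V T" "y \<in> desc c" "y \<noteq> c" by blast
    \<comment> \<open>A branch vertex \<open>y\<close> strictly below \<open>c\<close> would be a
      better choice than \<open>c\<close>.\<close>
    then have "card (desc y) < card (desc c)"
      using desc_psubset c(1) by (intro psubset_card_mono finite_desc)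
    then show False using least[OF T(1-3) y(1)] by simp
  qed
  obtain v where v: "v \<in> desc c" "v \<in> leaves V T" using deepest_desc_leaf c by blast
  have "(v, y) \<notin> E" if y: "y \<in> branches V T" "y \<noteq> c" for y
  proof
    assume "(v, y) \<in> E"
    then obtain T' where T': "leaf_branch_minimal V E T'" "u \<in> leaves V T'" "c \<in> branches V T'"
      "\<And>p' d'. rooted_tree V T' u p' d' \<Longrightarrow> rooted_tree.desc V u p' c \<subset> desc c"
      by (rule leg_move[OF assms(2) T(1,3,4) only v(2,1) y]) (rule that)
    have "spanning_tree_on V T'"
      using T'(1) by (simp add: leaf_branch_minimal_def leaf_minimal_def)
    then obtain p' d' where r: "rooted_tree V T' u p' d'"
      by (rule spanning_tree_on_rooted[OF assms(1) _ root_in])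
    have "card (rooted_tree.desc V u p' c) < card (desc c)"
      using T'(4)[OF r] by (intro psubset_card_mono finite_desc)
    then show False using least[OF T'(1) r T'(2,3)] by simp
  qed
  moreover have "v \<noteq> u" using v(1) root_notin_desc[OF c(2)] by blast
  ultimately show thesis using that T v(2) by blast
qed

text \<open>Four disjoint subsets of \<open>V\<close> are counted; omitting \<open>u\<close> from
  the leaves and \<open>c\<close> from the branch vertices accounts for the \<open>2\<close> on the
  right. \<open>T\<close> may differ from the given tree but has equally many leaves.\<close>

lemma degree_sum_bound:
  assumes "finite V" "E \<subseteq> V \<times> V" "sym E" "irrefl E"
    and "leaf_branch_minimal V E T\<^sub>0" "card (leaves V T\<^sub>0) \<ge> 3"
  obtains T u v where "spanning_tree_on V T" "T \<subseteq> E" "u \<in> V" "v \<in> V" "u \<noteq> v" "(u, v) \<notin> E"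
    "degree_in E u + degree_in E v + card (leaves V T) + card (branches V T) \<le> card V + 2"
proof -
  obtain T u p d c v where T: "leaf_branch_minimal V E T" "rooted_tree V T u p d"
    "u \<in> leaves V T" "v \<in> leaves V T" "v \<noteq> u" "c \<in> branches V T"
    and vB: "\<And>y. y \<in> branches V T \<Longrightarrow> y \<noteq> c \<Longrightarrow> (v, y) \<notin> E"
    using private_branch_leaf[OF assms(1,3,5,6)] by metis
  interpret rooted_tree V T u p d by fact
  have min: "leaf_minimal V E T" using T(1) by (simp add: leaf_branch_minimal_def)
  then have tree: "spanning_tree_on V T" "T \<subseteq> E" by (simp_all add: leaf_minimal_def)
  have "card (leaves V T\<^sub>0) \<le> card (leaves V T)"
    using assms(5) tree by (simp add: leaf_branch_minimal_def leaf_minimal_def)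
  then have L3: "card (leaves V T) \<ge> 3" using assms(6) by simp
  have uv: "u \<in> V" "v \<in> V" "degree_in T u = 1" "degree_in T v = 1"
    using T by (auto simp: leaves_def)
  have indep: "(a, b) \<notin> E" if "leaf_minimal V E T'" "card (leaves V T') \<ge> 3"
    "a \<in> leaves V T'" "b \<in> leaves V T'" "a \<noteq> b" for T' a b
    using leaf_minimal_independent[OF assms(1,3) that] .
  have finE: "finite (E `` {x})" for x
    using assms(1,2) finite_subset[of E "V \<times> V"] by (intro finite_Image) auto
  let ?N = "E `` {u}" and ?F = "p ` (E `` {u})"
  have N: "x \<in> V" "x \<noteq> u" "(x, u) \<in> E" if "x \<in> ?N" for x
    using that assms(2-4) by (auto simp: irrefl_def dest: symD)
  \<comment> \<open>The case \<open>p x = u\<close> occurs when \<open>x\<close> is the tree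
    neighbour of \<open>u\<close>; otherwise \<open>root_flip\<close> applies.\<close>
  have F_deg: "degree_in T (p x) = (if p x = u then 1 else 2)" if "x \<in> ?N" for x
    using root_flip(1)[OF assms(3) min T(3)] N[OF that] uv by auto
  \<comment> \<open>Either \<open>p x\<close> is the leaf \<open>u\<close>, or \<open>p x\<close>
    and \<open>v\<close> are both leaves of the flipped tree.\<close>
  have F_nonadj: "(v, p x) \<notin> E" if x: "x \<in> ?N" for x
  proof (cases "p x = u")
    case True
    then show ?thesis using indep[OF min L3 T(4,3,5)] by simp
  next
    case False
    obtain T' where T': "leaf_minimal V E T'" "leaves V T' = insert (p x) (leaves V T - {u})"
      using root_flip(2)[OF assms(3) min T(3)] N[OF x] False by blast
    have "card (leaves V T) \<le> card (leaves V T')"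
      using T'(1) min by (simp add: leaf_minimal_def)
    moreover have "v \<noteq> p x" using F_deg[OF x] False uv by auto
    ultimately show ?thesis
      using indep[OF T'(1), of v "p x"] T'(2) L3 T(4,5) by simp
  qed
  \<comment> \<open>By \<open>F_deg\<close>, each parent occurring here has room for a single
    child.\<close>
  have "inj_on p ?N"
  proof (rule inj_onI)
    fix x y assume xy: "x \<in> ?N" "y \<in> ?N" "p x = p y"
    show "x = y"
      by (rule unique_child) (use xy N F_deg[OF xy(1)] in auto)
  qed
  then have cardF: "card ?F = degree_in E u" by (simp add: degree_in_def card_image)
  have "p x \<notin> leaves V T - {u} \<and> p x \<notin> branches V T" if "x \<in> ?N" for x
    using F_deg[OF that] by (cases "p x = u") (simp_all add: leaves_def branches_def)
  then have F_L: "?F \<inter> (leaves V T - {u}) = {}" and F_B: "?F \<inter> (branches V T - {c}) = {}"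
    by blast+
  have v_L: "E `` {v} \<inter> (leaves V T - {u}) = {}"
    using indep[OF min L3 T(4)] assms(4) by (auto simp: irrefl_def)
  let ?L = "leaves V T - {u}" and ?B = "branches V T - {c}"
  have fin: "finite ?L" "finite ?B" "finite ?F" "finite (E `` {v})"
    using finE finite_leaves finite_branches finite_V by auto
  have LB: "?L \<inter> ?B = {}" by (auto simp: leaves_def branches_def)
  have "E `` {v} \<inter> ?F = {}" "E `` {v} \<inter> ?B = {}" using F_nonadj vB by blast+
  then have "(E `` {v} \<union> ?F) \<inter> ?L = {}" "(E `` {v} \<union> ?F \<union> ?L) \<inter> ?B = {}"
    using LB F_L F_B v_L by (simp_all add: Int_Un_distrib2)
  then have "card (E `` {v} \<union> ?F \<union> ?L \<union> ?B) = card (E `` {v}) + card ?F + card ?L + card ?B"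
    using fin \<open>E `` {v} \<inter> ?F = {}\<close> by (simp only: card_Un_disjoint finite_Un)
  moreover have "E `` {v} \<union> ?F \<union> ?L \<union> ?B \<subseteq> V"
    using assms(2) N parent_in by (auto simp: leaves_def branches_def)
  then have "card (E `` {v} \<union> ?F \<union> ?L \<union> ?B) \<le> card V"
    using assms(1) by (rule card_mono[rotated])
  moreover have "card ?L = card (leaves V T) - 1" "card ?B = card (branches V T) - 1"
    using T(3,6) by auto
  ultimately have "degree_in E u + degree_in E v + card (leaves V T) + card (branches V T) \<le> card V + 2"
    using cardF by (simp add: degree_in_def)
  then show thesis
    using that[OF tree uv(1,2)] T(5) indep[OF min L3 T(3,4)] by simp
qed

text \<open>With three or more leaves, \<open>degree_sum_bound\<close> is compared with
  \<open>ore\<close>, which is stated additively to avoid truncated subtraction. With fewer leaves,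
  leaves and branch vertices number at most two together, and \<open>k + 1\<close> is at least
  two.\<close>

lemma spanning_tree_few_leaves_branches:
  assumes "finite V" "V \<noteq> {}" "E \<subseteq> V \<times> V" "sym E" "irrefl E" "connected_on V E" "k \<ge> 1"
    and ore: "\<And>u v. u \<in> V \<Longrightarrow> v \<in> V \<Longrightarrow> u \<noteq> v \<Longrightarrow> (u, v) \<notin> E \<Longrightarrow>
      card V + 1 \<le> degree_in E u + degree_in E v + k"
  obtains T where "spanning_tree_on V T" "T \<subseteq> E" "card (leaves V T) + card (branches V T) \<le> k + 1"
proof -
  obtain T\<^sub>0 where T0: "leaf_branch_minimal V E T\<^sub>0"
    using connected_on_spanning_tree[OF assms(1-4,6)] leaf_branch_minimal_exists by metis
  then have tree: "spanning_tree_on V T\<^sub>0" "T\<^sub>0 \<subseteq> E"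
    by (auto simp: leaf_branch_minimal_def leaf_minimal_def)
  show thesis
  proof (cases "card (leaves V T\<^sub>0) \<ge> 3")
    case True
    then obtain T u v where T: "spanning_tree_on V T" "T \<subseteq> E"
      and uv: "u \<in> V" "v \<in> V" "u \<noteq> v" "(u, v) \<notin> E"
      and le: "degree_in E u + degree_in E v + card (leaves V T) + card (branches V T) \<le> card V + 2"
      by (rule degree_sum_bound[OF assms(1,3,4,5) T0])
    show thesis using that[OF T] le ore[OF uv] by linarith
  next
    case few: False
    have "card (leaves V T\<^sub>0) + card (branches V T\<^sub>0) \<le> 2"
    \<comment> \<open>\<open>card_leaves_ge\<close> leaves no room for branch vertices; a single
      vertex is treated apart, being outside its scope.\<close>
    proof (cases "card V \<ge> 2")
      case True
      then show ?thesis using card_leaves_ge[OF assms(1) tree(1)] few by simp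
    next
      case False
      have "leaves V T\<^sub>0 \<union> branches V T\<^sub>0 \<subseteq> V" "leaves V T\<^sub>0 \<inter> branches V T\<^sub>0 = {}"
        by (auto simp: leaves_def branches_def)
      then have "card (leaves V T\<^sub>0) + card (branches V T\<^sub>0) \<le> card V"
        using assms(1) finite_leaves finite_branches
        by (metis card_Un_disjoint card_mono)
      then show ?thesis using False by simp
    qed
    then show thesis using that[OF tree] assms(7) by simp
  qed
qed

section \<open>Absence of cycles\<close>

lemma pcas_rtrancl: "pcas x q y \<Longrightarrow> set q \<subseteq> R \<Longrightarrow> (x, y) \<in> R\<^sup>*"
  by (induction q arbitrary: x) (auto intro: converse_rtrancl_into_rtrancl)

lemma pcas_last_in_verts: "pcas x q y \<Longrightarrow> y \<in> set (pawalk_verts x q)"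
  by (induction q arbitrary: x) auto

lemma pcas_first_in_verts: "pcas x q y \<Longrightarrow> x \<in> set (pawalk_verts x q)"
  by (cases q) auto

lemma pcas_arc_in_verts:
  "pcas x q y \<Longrightarrow> (a, b) \<in> set q \<Longrightarrow> a \<in> set (pawalk_verts x q) \<and> b \<in> set (pawalk_verts x q)"
proof (induction q arbitrary: x)
  case (Cons e q)
  then show ?case using pcas_first_in_verts[of "snd e" q y] by auto
qed simp

text \<open>Removing an edge of a cycle would leave a connected graph with too few edges.\<close>

lemma spanning_tree_on_no_cycle:
  assumes "finite V" "spanning_tree_on V T"
    and "pre_digraph.cycle (with_proj \<lparr>pverts = V, parcs = T\<rparr>) cyc" "length cyc \<ge> 3"
  shows False
proof -
  have T: "T \<subseteq> V \<times> V" "sym T" "irrefl T" "connected_on V T" "card T = 2 * (card V - 1)"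
    using assms(2) by (auto simp: spanning_tree_on_def)
  obtain u where cyc: "set cyc \<subseteq> T" "pcas u cyc u" "distinct (tl (pawalk_verts u cyc))"
    using assms(3)
    by (auto simp: pre_digraph.cycle_def pre_digraph.awalk_def cas_with_proj_eq
        awalk_verts_with_proj_eq)
  obtain e f g q where q: "cyc = e # f # g # q"
    using assms(4) by (metis One_nat_def Suc_le_length_iff numeral_3_eq_3)
  obtain x z t where e: "e = (u, x)" "f = (x, z)" "g = (z, t)"
    using cyc(2) by (cases e; cases f; cases g) (auto simp: q)
  have walk: "pcas x (f # g # q) u" "pcas z (g # q) u" "pcas t q u"
    and dist: "x \<notin> set (pawalk_verts z (g # q))" "z \<notin> set (pawalk_verts t q)"
    using cyc by (auto simp: q e)
  have "u \<noteq> x" using T(3) cyc(1) by (auto simp: q e irrefl_def)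
  \<comment> \<open>This is where length at least three enters: on the closed walk \<open>u\<close>,
    \<open>x\<close>, \<open>u\<close> the second arc would be the reverse of the first.\<close>
  have "z \<noteq> u" using pcas_last_in_verts[OF walk(3)] dist(2) by auto
  define R where "R = T - {(u, x), (x, u)}"
  \<comment> \<open>After its second arc the cycle never returns to \<open>x\<close>.\<close>
  have "(u, x) \<notin> set (g # q)" "(x, u) \<notin> set (g # q)"
    using pcas_arc_in_verts[OF walk(2)] dist(1) by blast+
  then have "set (f # g # q) \<subseteq> R"
    using cyc(1) \<open>u \<noteq> x\<close> \<open>z \<noteq> u\<close> unfolding R_def q e by auto
  then have xu: "(x, u) \<in> R\<^sup>*" using pcas_rtrancl[OF walk(1)] by blast
  have symR: "sym R" using T(2) by (auto simp: R_def sym_def)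
  have "(u, x) \<in> R\<^sup>*" using xu symD[OF sym_rtrancl[OF symR]] by blast
  then have "T \<subseteq> R\<^sup>*" using xu by (auto simp: R_def)
  then have "T\<^sup>* \<subseteq> R\<^sup>*" by (rule rtrancl_subset_rtrancl)
  then have "connected_on V R" using T(4) by (auto simp: connected_on_def)
  moreover have "R \<subseteq> V \<times> V" using T(1) by (auto simp: R_def)
  ultimately have "card R \<ge> 2 * (card V - 1)"
    using connected_on_card_ge assms(1) symR by blast
  moreover have "R \<subset> T" using cyc(1) by (auto simp: R_def q e)
  then have "card R < card T"
    using T(1) assms(1) finite_subset[of T "V \<times> V"] by (intro psubset_card_mono) auto
  ultimately show False using T(5) by simp
qed

section \<open>Transfer to pair graphs\<close>

lemma deg_eq_degree_in: "deg G v = degree_in (parcs G) v"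
proof -
  have "out_arcs (with_proj G) v = Pair v ` (parcs G `` {v})"
    by (auto simp: out_arcs_def)
  then show ?thesis by (simp add: out_degree_def degree_in_def card_image inj_on_def)
qed

lemma pair_graph_iff:
  "pair_graph G \<longleftrightarrow> finite (pverts G) \<and> parcs G \<subseteq> pverts G \<times> pverts G \<and> sym (parcs G) \<and>
    irrefl (parcs G)"
proof
  assume "pair_graph G"
  then interpret pair_graph G .
  show "finite (pverts G) \<and> parcs G \<subseteq> pverts G \<times> pverts G \<and> sym (parcs G) \<and> irrefl (parcs G)"
    using pair_finite_verts in_arcsD1 in_arcsD2 pair_sym_arcs pair_no_loops
    by (force simp: irrefl_def symmetric_def)
next
  assume G: "finite (pverts G) \<and> parcs G \<subseteq> pverts G \<times> pverts G \<and> sym (parcs G) \<and> irrefl (parcs G)"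
  then have "finite (parcs G)" using finite_subset by blast
  then show "pair_graph G"
    using G by unfold_locales (auto simp: irrefl_def symmetric_def)
qed

text \<open>Connectivity means strong connectivity of the symmetric closure, which adds no arcs
  here; it includes that there is a vertex.\<close>

lemma connected_iff_connected_on:
  assumes "pair_graph G"
  shows "Digraph_Component.connected (with_proj G) \<longleftrightarrow>
    pverts G \<noteq> {} \<and> connected_on (pverts G) (parcs G)"
proof -
  interpret pair_graph G by fact
  show ?thesis
    unfolding Digraph_Component.connected_def strongly_connected_def connected_on_def
    using reachable_mk_symmetric_eq[OF pair_sym_arcs] reachable_conv
    by simp
qed

lemma undirected_spanning_tree_of_spanning_tree_on:
  assumes "pair_graph G" "pverts G \<noteq> {}" "spanning_tree_on (pverts G) T" "T \<subseteq> parcs G"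
  shows "undirected_spanning_tree \<lparr>pverts = pverts G, parcs = T\<rparr> G"
proof -
  let ?H = "\<lparr>pverts = pverts G, parcs = T\<rparr>"
  have fin: "finite (pverts G)" using assms(1) by (simp add: pair_graph_iff)
  have H: "pair_graph ?H"
    using assms fin by (simp add: pair_graph_iff spanning_tree_on_def)
  interpret G: pair_graph G by fact
  interpret H: pair_graph ?H by fact
  have "Digraph_Component.connected (with_proj ?H)"
    using connected_iff_connected_on[OF H] assms by (simp add: spanning_tree_on_def)
  moreover have "spanning (with_proj ?H) (with_proj G)"
    using assms(4) G.wf_digraph H.wf_digraph
    by (simp add: spanning_def subgraph_def compatible_def)
  ultimately show ?thesis
    unfolding undirected_spanning_tree_def undirected_tree_def
    using H spanning_tree_on_no_cycle[OF fin assms(3)] by blast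
qed

lemma sigma2_le:
  assumes "u \<in> pverts G" "v \<in> pverts G" "u \<noteq> v" "(u, v) \<notin> parcs G"
  shows "sigma2 G \<le> enat (deg G u + deg G v)"
  unfolding sigma2_def by (rule INF_lower2[of "(u, v)"]) (use assms in auto)

theorem theorem1:
  fixes G :: "'a pair_pre_digraph" and n k :: nat
  assumes "pair_graph G"
    and "Digraph_Component.connected (with_proj G)"
    and "card (pverts G) = n"
    and "k \<ge> 1"
    and "ereal_of_enat (sigma2 G) \<ge> ereal (real n - real k + 1)"
  shows "\<exists>T. undirected_spanning_tree T G \<and>
           int (card (end_vertices T)) \<le> int k - int (card (branch_vertices T)) + 1"
proof -
  let ?V = "pverts G" and ?E = "parcs G"
  have G: "finite ?V" "?E \<subseteq> ?V \<times> ?V" "sym ?E" "irrefl ?E"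
    using assms(1) by (auto simp: pair_graph_iff)
  have conn: "?V \<noteq> {}" "connected_on ?V ?E"
    using connected_iff_connected_on[OF assms(1)] assms(2) by auto
  \<comment> \<open>For a complete graph this is vacuous, so an infinite \<open>sigma2\<close> needs
    no separate case.\<close>
  have ore: "card ?V + 1 \<le> degree_in ?E u + degree_in ?E v + k"
    if "u \<in> ?V" "v \<in> ?V" "u \<noteq> v" "(u, v) \<notin> ?E" for u v
  proof -
    have "ereal (real n - real k + 1) \<le> ereal_of_enat (enat (deg G u + deg G v))"
      using assms(5) sigma2_le[OF that] by (meson ereal_of_enat_le_iff order_trans)
    then have "real n - real k + 1 \<le> real (deg G u + deg G v)" by simp
    then show ?thesis using assms(3) by (simp add: deg_eq_degree_in)
  qed
  obtain T where T: "spanning_tree_on ?V T" "T \<subseteq> ?E"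
    and le: "card (leaves ?V T) + card (branches ?V T) \<le> k + 1"
    using spanning_tree_few_leaves_branches[OF G(1) conn(1) G(2-4) conn(2) assms(4) ore] by blast
  let ?H = "\<lparr>pverts = ?V, parcs = T\<rparr>"
  have "end_vertices ?H = leaves ?V T" "branch_vertices ?H = branches ?V T"
    by (simp_all add: end_vertices_def branch_vertices_def leaves_def branches_def deg_eq_degree_in)
  then have "int (card (end_vertices ?H)) \<le> int k - int (card (branch_vertices ?H)) + 1"
    using le by simp
  then show ?thesis
    using undirected_spanning_tree_of_spanning_tree_on[OF assms(1) conn(1) T] by blast
qed

end
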